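(* Let $S\subset\mathbb{R}^2$ be a closed set such that $\partial S$ is path-connected and $S=\overline{\mathrm{int}(S)}$. Let $b_1,b_2\in\mathbb{R}^2$ be orthonormal vectors and put $\xi=(b_1+b_2)/\|b_1+b_2\|$. Then $S$ is biconvex with respect to $b_1,b_2$ if and only if for all $x\in\partial S$ there exists $i\in\{0,1,2,3\}$ such that $C_{R^i(\xi)}(x)\cap S=\emptyset$.
   Context: $\mathbb{R}^2$ carries the Euclidean norm $\|\cdot\|$ and inner product $\langle\cdot,\cdot\rangle$; $\partial S$, $\mathrm{int}(S)$ and $\overline{S}$ denote boundary, interior and closure of $S$. Biconvexity: given orthonormal vectors $b_1,b_2$, a set $S\subset\mathbb{R}^2$ is biconvex with respect to $b_1,b_2$ if for all $\alpha,\beta\in\mathbb{R}$ the sets $\{\alpha b_1+tb_2:t\in\mathbb{R}\}\cap S$ and $\{tb_1+\beta b_2:t\in\mathbb{R}\}\cap S$ are convex (possibly empty). Rotations and cones: $R$ is the counter-clockwise rotation of angle $\pi/2$ about the origin, $R^0(\xi)=\xi$ and $R^i(\xi)=R(R^{i-1}(\xi))$ for $i=1,2,3$. For a unit vector $v$ and $x\in\mathbb{R}^2$, $C_v(x)$ is the open infinite cone with vertex $x$, axis direction $v$ and opening angle $\pi/2$: $$C_v(x)=\Big\{z\in\mathbb{R}^2,\ z\neq x:\ \Big\langle v,\frac{z-x}{\|z-x\|}\Big\rangle>\cos(\pi/4)\Big\}.$$ *)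

theory Defs
  imports "HOL-Analysis.Analysis"
begin

definition biconvex :: "real^2 \<Rightarrow> real^2 \<Rightarrow> (real^2) set \<Rightarrow> bool" where
  "biconvex b1 b2 S \<longleftrightarrow>
     (\<forall>\<alpha>::real. convex ({\<alpha> *\<^sub>R b1 + t *\<^sub>R b2 | t. t \<in> UNIV} \<inter> S)) \<and>
     (\<forall>\<beta>::real. convex ({t *\<^sub>R b1 + \<beta> *\<^sub>R b2 | t. t \<in> UNIV} \<inter> S))"

text \<open>Counter-clockwise rotation by the angle \<open>\<pi>/2\<close> about the origin, that is,
  the map \<open>(x, y) \<mapsto> (-y, x)\<close>.\<close>

definition rot90 :: "real^2 \<Rightarrow> real^2" where
  "rot90 x = vector [- (x $ 2), x $ 1]"

text \<open>The open infinite cone with vertex \<open>x\<close>, axis direction \<open>v\<close> (meant to be a unit vector)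
  and full opening angle \<open>\<pi>/2\<close>, so that the half-angle is \<open>\<pi>/4\<close>.\<close>

definition open_cone :: "real^2 \<Rightarrow> real^2 \<Rightarrow> (real^2) set" where
  "open_cone v x = {z. z \<noteq> x \<and> v \<bullet> ((z - x) /\<^sub>R norm (z - x)) > cos (pi / 4)}"

end

theory Submission
  imports Defs
begin

text \<open>
  In coordinates along \<open>b1\<close>, \<open>b2\<close> the four cones at \<open>x\<close> are the open quadrants at \<open>x\<close>.
  A closed set with connected frontier is connected. If \<open>S\<close> is connected and biconvex and all
  four quadrants at \<open>x\<close> meet \<open>S\<close>, then \<open>S\<close> meets all four open half-axes at \<open>x\<close>, hence contains a
  small cross around \<open>x\<close>, hence small squares in all quadrants: otherwise \<open>S\<close> could be separated
  along the boundary of a translated quadrant. So \<open>x\<close> is not a frontier point.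

  Conversely let \<open>r \<notin> S\<close> lie between \<open>p, q \<in> S\<close> on a horizontal line. The connected frontier has
  points on both sides of the vertical line through \<open>r\<close>, so \<open>S\<close> meets this line, say below \<open>r\<close>.
  Regularity of \<open>S\<close> yields an interior point \<open>s'\<close> nearby, and on the vertical
  segment from \<open>s'\<close> up to the height of \<open>r\<close> there is a frontier point \<open>w\<close>: its upper quadrants
  contain \<open>p\<close> and \<open>q\<close>, its lower ones contain points close to \<open>s'\<close>.
\<close>

section \<open>Axis-parallel convexity and quadrants, in coordinates\<close>

text \<open>Inner products replace parametrised lines, so that the condition is visibly unaffected
  by the sign of either vector and arguments about the four quadrants reduce to one. Fixing the
  order of \<open>p\<close> and \<open>q\<close> along \<open>v\<close> loses nothing, since both
  range over all of \<open>S\<close>.\<close>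

definition line_convex :: "'a::real_inner \<Rightarrow> 'a \<Rightarrow> 'a set \<Rightarrow> bool" where
  "line_convex u v S \<longleftrightarrow> (\<forall>p\<in>S. \<forall>q\<in>S. \<forall>z. p \<bullet> u = z \<bullet> u \<and> q \<bullet> u = z \<bullet> u \<and>
     p \<bullet> v \<le> z \<bullet> v \<and> z \<bullet> v \<le> q \<bullet> v \<longrightarrow> z \<in> S)"

definition quadrant :: "'a::real_inner \<Rightarrow> 'a \<Rightarrow> 'a \<Rightarrow> 'a set" where
  "quadrant u v x = {z. z \<bullet> u > x \<bullet> u \<and> z \<bullet> v > x \<bullet> v}"

definition orthonormal :: "'a::real_inner \<Rightarrow> 'a \<Rightarrow> bool" where
  "orthonormal u v \<longleftrightarrow> u \<bullet> u = 1 \<and> v \<bullet> v = 1 \<and> u \<bullet> v = 0 \<and> v \<bullet> u = 0"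

lemma orthonormal_sym: "orthonormal u v \<Longrightarrow> orthonormal v u"
  by (auto simp: orthonormal_def)

lemma orthonormal_minus [simp]:
  "orthonormal (-u) v \<longleftrightarrow> orthonormal u v" "orthonormal u (-v) \<longleftrightarrow> orthonormal u v"
  by (auto simp: orthonormal_def)

lemma line_convexD:
  assumes "line_convex u v S" "p \<in> S" "q \<in> S" "p \<bullet> u = z \<bullet> u" "q \<bullet> u = z \<bullet> u"
    "p \<bullet> v \<le> z \<bullet> v" "z \<bullet> v \<le> q \<bullet> v"
  shows "z \<in> S"
  using assms unfolding line_convex_def by blast

lemma line_convex_minus [simp]:
  "line_convex (-u) v S \<longleftrightarrow> line_convex u v S" "line_convex u (-v) S \<longleftrightarrow> line_convex u v S"
  unfolding line_convex_def by (auto simp: inner_minus_right)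

section \<open>Biconvex connected sets near a point whose four quadrants they meet\<close>

text \<open>A connected set with points inside and outside an open quadrant meets the frontier of
  that quadrant, which lies in the closed quadrant minus the open one.\<close>

lemma connected_meets_corner:
  fixes S :: "'a::real_inner set"
  assumes "connected S" "q \<in> S" "q \<bullet> u > \<alpha>" "q \<bullet> v > \<beta>"
    and "p \<in> S" "\<not> (p \<bullet> u > \<alpha> \<and> p \<bullet> v > \<beta>)"
  obtains w where "w \<in> S"
    "w \<bullet> u = \<alpha> \<and> w \<bullet> v \<ge> \<beta> \<or> w \<bullet> v = \<beta> \<and> w \<bullet> u \<ge> \<alpha>"
proof -
  define G where "G = {z. u \<bullet> z > \<alpha>} \<inter> {z. v \<bullet> z > \<beta>}"
  have "open G"
    unfolding G_def by (intro open_Int open_halfspace_gt)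
  have "closure G \<subseteq> {z. u \<bullet> z \<ge> \<alpha>} \<inter> {z. v \<bullet> z \<ge> \<beta>}"
    by (intro closure_minimal closed_Int closed_halfspace_ge) (auto simp: G_def)
  moreover have "S \<inter> frontier G \<noteq> {}"
    using assms by (intro connected_Int_frontier) (auto simp: G_def inner_commute)
  ultimately obtain w where "w \<in> S" "w \<notin> G" "u \<bullet> w \<ge> \<alpha>" "v \<bullet> w \<ge> \<beta>"
    using \<open>open G\<close> by (auto simp: frontier_def interior_open)
  then show ?thesis
    by (intro that[of w]) (auto simp: G_def inner_commute)
qed

text \<open>Think of \<open>u\<close> as horizontal. Let \<open>z\<close> be the foot on the axis of
  whichever of \<open>p\<close>, \<open>q\<close> is nearer to \<open>x\<close> along
  \<open>u\<close>, and apply the corner argument to the quadrant with vertex \<open>z\<close> that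
  opens towards the other point. A point of \<open>S\<close> on the horizontal edge is already on
  the half-axis; one on the vertical edge yields \<open>z\<close> itself by line convexity.\<close>

lemma connected_meets_half_axis:
  assumes "connected S" "orthonormal u v" "line_convex u v S"
    and "p \<in> S" "p \<in> quadrant u v x" "q \<in> S" "q \<in> quadrant u (-v) x"
  obtains w where "w \<in> S" "w \<bullet> u > x \<bullet> u" "w \<bullet> v = x \<bullet> v"
proof -
  \<comment> \<open>The case in which \<open>p\<close> is the nearer point. It is proved for
    arbitrary \<open>v\<close>, \<open>p\<close>, \<open>q\<close>, so that the other case follows
    by passing to \<open>-v\<close> and exchanging the points.\<close>
  have *: "\<exists>w\<in>S. w \<bullet> u > x \<bullet> u \<and> w \<bullet> v = x \<bullet> v"
    if "orthonormal u v" "line_convex u v S" "p \<in> S" "p \<in> quadrant u v x"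
      "q \<in> S" "q \<in> quadrant u (-v) x" "p \<bullet> u \<le> q \<bullet> u" for v p q
  proof -
    define z where "z = x + (p \<bullet> u - x \<bullet> u) *\<^sub>R u"
    have z: "z \<bullet> u = p \<bullet> u" "z \<bullet> v = x \<bullet> v"
      using that(1) by (auto simp: z_def orthonormal_def inner_add_left)
    have z': ?thesis if "w \<in> S" "w \<bullet> u = p \<bullet> u" "w \<bullet> v \<le> x \<bullet> v" for w
    proof -
      have "z \<in> S"
        using \<open>p \<in> quadrant u v x\<close> that z
        by (intro line_convexD[OF \<open>line_convex u v S\<close> \<open>w \<in> S\<close> \<open>p \<in> S\<close>]) (auto simp: quadrant_def)
      then show ?thesis
        using z \<open>p \<in> quadrant u v x\<close> by (intro bexI[of _ z]) (auto simp: quadrant_def)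
    qed
    show ?thesis
    proof (cases "p \<bullet> u = q \<bullet> u")
      case True
      then show ?thesis
        using z'[of q] that by (auto simp: quadrant_def)
    next
      case False
      then have "q \<bullet> u > p \<bullet> u" "q \<bullet> (-v) > x \<bullet> (-v)" "\<not> (p \<bullet> u > p \<bullet> u \<and> p \<bullet> (-v) > x \<bullet> (-v))"
        using that by (auto simp: quadrant_def)
      then obtain w where "w \<in> S"
        "w \<bullet> u = p \<bullet> u \<and> w \<bullet> (-v) \<ge> x \<bullet> (-v) \<or> w \<bullet> (-v) = x \<bullet> (-v) \<and> w \<bullet> u \<ge> p \<bullet> u"
        using connected_meets_corner[OF \<open>connected S\<close> \<open>q \<in> S\<close> _ _ \<open>p \<in> S\<close>] by metis
      then show ?thesis
        using z'[of w] \<open>p \<in> quadrant u v x\<close>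
        by (cases "w \<bullet> u = p \<bullet> u") (auto simp: quadrant_def intro: bexI[of _ w])
    qed
  qed
  show ?thesis
  proof (cases "p \<bullet> u \<le> q \<bullet> u")
    case True
    then show ?thesis
      using *[of v p q] assms that by blast
  next
    case False
    then show ?thesis
      using *[of "-v" q p] assms that by auto
  qed
qed

text \<open>For \<open>z\<close> in a small square at \<open>x\<close>, the projections
  \<open>g\<close> and \<open>h\<close> of \<open>z\<close> to the two half-axes lie in
  \<open>S\<close>, between \<open>x\<close> and \<open>e\<close> or \<open>f\<close>. As
  \<open>p\<close> is in the open quadrant at \<open>z\<close> and \<open>x\<close> is not,
  \<open>S\<close> has a point \<open>w\<close> on its edges; then \<open>z\<close> lies between
  \<open>w\<close> and \<open>g\<close>, or between \<open>w\<close> and \<open>h\<close>, on a line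
  parallel to an axis.\<close>

lemma quadrant_locally_subset:
  assumes "connected S" "orthonormal u v" "line_convex u v S" "line_convex v u S" "x \<in> S"
    and "e \<in> S" "e \<bullet> u > x \<bullet> u" "e \<bullet> v = x \<bullet> v"
    and "f \<in> S" "f \<bullet> v > x \<bullet> v" "f \<bullet> u = x \<bullet> u"
    and "p \<in> S" "p \<in> quadrant u v x"
  shows "\<exists>\<delta>>0. \<forall>z. x \<bullet> u \<le> z \<bullet> u \<and> z \<bullet> u < x \<bullet> u + \<delta> \<and> x \<bullet> v \<le> z \<bullet> v \<and> z \<bullet> v < x \<bullet> v + \<delta>
    \<longrightarrow> z \<in> S"
proof -
  \<comment> \<open>The first two entries keep \<open>g\<close> before \<open>e\<close> and
    \<open>h\<close> before \<open>f\<close>; the last two keep \<open>p\<close> in the open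
    quadrant at \<open>z\<close>.\<close>
  define \<delta> where "\<delta> = Min {e \<bullet> u - x \<bullet> u, f \<bullet> v - x \<bullet> v, p \<bullet> u - x \<bullet> u, p \<bullet> v - x \<bullet> v}"
  have "\<delta> > 0"
    using assms by (auto simp: \<delta>_def quadrant_def)
  have \<delta>: "x \<bullet> u + \<delta> \<le> e \<bullet> u" "x \<bullet> v + \<delta> \<le> f \<bullet> v" "x \<bullet> u + \<delta> \<le> p \<bullet> u" "x \<bullet> v + \<delta> \<le> p \<bullet> v"
    by (simp_all add: \<delta>_def min_le_iff_disj)
  have "z \<in> S" if z: "x \<bullet> u \<le> z \<bullet> u" "z \<bullet> u < x \<bullet> u + \<delta>" "x \<bullet> v \<le> z \<bullet> v" "z \<bullet> v < x \<bullet> v + \<delta>" for z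
  proof -
    define g where "g = x + (z \<bullet> u - x \<bullet> u) *\<^sub>R u"
    define h where "h = x + (z \<bullet> v - x \<bullet> v) *\<^sub>R v"
    have gh: "g \<bullet> u = z \<bullet> u" "g \<bullet> v = x \<bullet> v" "h \<bullet> u = x \<bullet> u" "h \<bullet> v = z \<bullet> v"
      using assms(2) by (auto simp: g_def h_def orthonormal_def inner_add_left)
    have "g \<in> S"
      using line_convexD[OF assms(4) \<open>x \<in> S\<close> \<open>e \<in> S\<close>, of g] gh assms z \<delta> by auto
    have "h \<in> S"
      using line_convexD[OF assms(3) \<open>x \<in> S\<close> \<open>f \<in> S\<close>, of h] gh assms z \<delta> by auto
    obtain w where "w \<in> S"
      "w \<bullet> u = z \<bullet> u \<and> w \<bullet> v \<ge> z \<bullet> v \<or> w \<bullet> v = z \<bullet> v \<and> w \<bullet> u \<ge> z \<bullet> u"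
      using connected_meets_corner[OF assms(1) \<open>p \<in> S\<close>, of "z \<bullet> u" u "z \<bullet> v" v x] z \<delta> \<open>x \<in> S\<close> by auto
    then show ?thesis
      using line_convexD[OF assms(3) \<open>g \<in> S\<close> \<open>w \<in> S\<close>, of z]
        line_convexD[OF assms(4) \<open>h \<in> S\<close> \<open>w \<in> S\<close>, of z] gh z by auto
  qed
  with \<open>\<delta> > 0\<close> show ?thesis by blast
qed

text \<open>Every component of \<open>S\<close> touches the frontier unless \<open>S\<close> is the
  whole space: otherwise it would be open and closed. Any two points can then be linked through the
  connected frontier.\<close>

lemma connected_of_connected_frontier:
  fixes S :: "'a::euclidean_space set"
  assumes "closed S" "connected (frontier S)"
  shows "connected S"
proof (cases "S = UNIV")
  case False
  have meet: "\<exists>f\<in>frontier S. connected_component S y f" if "y \<in> S" for y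
  proof (rule ccontr)
    define C where "C = connected_component_set S y"
    assume "\<not> ?thesis"
    then have "C \<subseteq> interior S"
      using connected_component_subset[of S y] \<open>closed S\<close>
      by (auto simp: C_def frontier_def)
    moreover have "y \<in> C"
      using that by (simp add: C_def)
    \<comment> \<open>A component of \<open>S\<close> that stays in the interior is a component of
      the interior, hence open.\<close>
    ultimately have "C \<subseteq> connected_component_set (interior S) y"
      by (intro connected_component_maximal) (auto simp: C_def)
    moreover have "connected_component_set (interior S) y \<subseteq> C"
      unfolding C_def by (intro connected_component_mono interior_subset)
    ultimately have "open C"
      by (metis open_connected_component open_interior subset_antisym)
    moreover have "closed C"
      unfolding C_def using \<open>closed S\<close> by (rule closed_connected_component)
    ultimately have "C = UNIV"
      using \<open>y \<in> C\<close> clopen[of C] by auto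
    then show False
      using False \<open>C \<subseteq> interior S\<close> interior_subset[of S] by auto
  qed
  have "frontier S \<subseteq> S"
    using \<open>closed S\<close> by (rule frontier_subset_closed)
  then have "connected_component S f g" if "f \<in> frontier S" "g \<in> frontier S" for f g
    using that assms(2) unfolding connected_component_def by blast
  then have "connected_component S a b" if "a \<in> S" "b \<in> S" for a b
    using meet[OF that(1)] meet[OF that(2)]
    by (meson connected_component_sym connected_component_trans)
  then show ?thesis
    by (auto simp: connected_iff_connected_component)
qed (simp add: convex_connected)

text \<open>This is the forward implication in contrapositive form. Two adjacent quadrants give a
  point on the half-axis between them, and each quadrant then gives a small square; the four squares
  cover a ball.\<close>

lemma interior_if_quadrants_meet:
  fixes S :: "'a::euclidean_space set"
  assumes "connected S" "orthonormal u v" "line_convex u v S" "line_convex v u S" "x \<in> S"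
    and meets: "\<And>a b. a \<in> {u, -u} \<Longrightarrow> b \<in> {v, -v} \<Longrightarrow> quadrant a b x \<inter> S \<noteq> {}"
  shows "x \<in> interior S"
proof -
  have axis1: "\<exists>w\<in>S. w \<bullet> a > x \<bullet> a \<and> w \<bullet> v = x \<bullet> v" if a: "a \<in> {u, -u}" for a
  proof -
    obtain p q where "p \<in> S" "p \<in> quadrant a v x" "q \<in> S" "q \<in> quadrant a (-v) x"
      using meets[OF a, of v] meets[OF a, of "-v"] by blast
    moreover have "orthonormal a v" "line_convex a v S"
      using a assms orthonormal_sym[OF assms(2)] by auto
    ultimately show ?thesis
      using connected_meets_half_axis[OF \<open>connected S\<close>] by metis
  qed
  have axis2: "\<exists>w\<in>S. w \<bullet> b > x \<bullet> b \<and> w \<bullet> u = x \<bullet> u" if b: "b \<in> {v, -v}" for b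
  proof -
    obtain p q where "p \<in> S" "p \<in> quadrant b u x" "q \<in> S" "q \<in> quadrant b (-u) x"
      using meets[OF _ b, of u] meets[OF _ b, of "-u"] by (auto simp: quadrant_def)
    moreover have "orthonormal b u" "line_convex b u S"
      using b assms orthonormal_sym[OF assms(2)] by auto
    ultimately show ?thesis
      using connected_meets_half_axis[OF \<open>connected S\<close>] by metis
  qed
  have "\<exists>\<delta>>0. \<forall>z. x \<bullet> a \<le> z \<bullet> a \<and> z \<bullet> a < x \<bullet> a + \<delta> \<and> x \<bullet> b \<le> z \<bullet> b \<and> z \<bullet> b < x \<bullet> b + \<delta> \<longrightarrow> z \<in> S"
    if ab: "a \<in> {u, -u}" "b \<in> {v, -v}" for a b
  proof -
    obtain e f p where "e \<in> S" "e \<bullet> a > x \<bullet> a" "e \<bullet> v = x \<bullet> v"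
      "f \<in> S" "f \<bullet> b > x \<bullet> b" "f \<bullet> u = x \<bullet> u" "p \<in> S" "p \<in> quadrant a b x"
      using axis1[OF ab(1)] axis2[OF ab(2)] meets[OF ab] by blast
    moreover have "orthonormal a b" "line_convex a b S" "line_convex b a S"
      using ab assms orthonormal_sym[OF assms(2)] by auto
    ultimately show ?thesis
      using ab by (intro quadrant_locally_subset[of S a b x e f p]) (use assms in auto)
  qed
  then obtain \<delta> where \<delta>: "\<And>a b. a \<in> {u, -u} \<Longrightarrow> b \<in> {v, -v} \<Longrightarrow> \<delta> a b > 0"
    "\<And>a b z. a \<in> {u, -u} \<Longrightarrow> b \<in> {v, -v} \<Longrightarrow> x \<bullet> a \<le> z \<bullet> a \<Longrightarrow> z \<bullet> a < x \<bullet> a + \<delta> a b \<Longrightarrow>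
      x \<bullet> b \<le> z \<bullet> b \<Longrightarrow> z \<bullet> b < x \<bullet> b + \<delta> a b \<Longrightarrow> z \<in> S"
    by metis
  define \<epsilon> where "\<epsilon> = Min ((\<lambda>(a, b). \<delta> a b) ` ({u, -u} \<times> {v, -v}))"
  have "\<epsilon> > 0"
    using \<delta>(1) unfolding \<epsilon>_def by (subst Min_gr_iff) auto
  have \<epsilon>: "\<epsilon> \<le> \<delta> a b" if "a \<in> {u, -u}" "b \<in> {v, -v}" for a b
    unfolding \<epsilon>_def using that by (intro Min_le) force+
  have "z \<in> S" if "z \<in> ball x \<epsilon>" for z
  proof -
    have "norm u = 1" "norm v = 1"
      using assms(2) by (auto simp: orthonormal_def norm_eq_sqrt_inner)
    then have zb: "\<bar>(z - x) \<bullet> u\<bar> < \<epsilon>" "\<bar>(z - x) \<bullet> v\<bar> < \<epsilon>"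
      using that Cauchy_Schwarz_ineq2[of "z - x" u] Cauchy_Schwarz_ineq2[of "z - x" v]
      by (auto simp: dist_norm norm_minus_commute)
    \<comment> \<open>The signs are chosen so that \<open>z\<close> lies in the closed quadrant at
      \<open>x\<close> spanned by \<open>a\<close> and \<open>b\<close>.\<close>
    define a where "a = (if z \<bullet> u \<ge> x \<bullet> u then u else -u)"
    define b where "b = (if z \<bullet> v \<ge> x \<bullet> v then v else -v)"
    have ab: "a \<in> {u, -u}" "b \<in> {v, -v}"
      by (auto simp: a_def b_def)
    have "x \<bullet> a \<le> z \<bullet> a" "z \<bullet> a < x \<bullet> a + \<epsilon>" "x \<bullet> b \<le> z \<bullet> b" "z \<bullet> b < x \<bullet> b + \<epsilon>"
      using zb by (auto simp: a_def b_def inner_diff_left)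
    then show ?thesis
      using \<delta>(2)[OF ab, of z] \<epsilon>[OF ab] by linarith
  qed
  then show ?thesis
    using \<open>\<epsilon> > 0\<close> by (auto simp: mem_interior)
qed

section \<open>Coordinates in the plane and the converse implication\<close>

text \<open>By dimension, \<open>u\<close> and \<open>v\<close> span the plane, so
  \<open>y - z\<close>, being orthogonal to both, is orthogonal to itself.\<close>

lemma orthonormal_plane_eqI:
  fixes u v y z :: "real^2"
  assumes "orthonormal u v" "y \<bullet> u = z \<bullet> u" "y \<bullet> v = z \<bullet> v"
  shows "y = z"
proof -
  have "pairwise orthogonal {u, v}" "0 \<notin> {u, v}" "u \<noteq> v"
    using assms(1) by (auto simp: orthonormal_def pairwise_def orthogonal_def)
  then have "independent {u, v}" "card {u, v} = DIM(real^2)"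
    by (auto simp: pairwise_orthogonal_independent)
  then have "span {u, v} = UNIV"
    using card_ge_dim_independent[of "{u, v}" UNIV] by auto
  moreover have "orthogonal (y - z) w" if "w \<in> span {u, v}" for w
    by (rule orthogonal_to_span[OF that]) (use assms in \<open>auto simp: orthogonal_def inner_diff_left\<close>)
  ultimately have "orthogonal (y - z) (y - z)"
    by blast
  then show ?thesis by (simp add: orthogonal_def)
qed

lemma orthonormal_plane_expand:
  fixes u v z :: "real^2"
  assumes "orthonormal u v"
  shows "z = (z \<bullet> u) *\<^sub>R u + (z \<bullet> v) *\<^sub>R v"
  using assms by (intro orthonormal_plane_eqI[OF assms]) (auto simp: orthonormal_def inner_add_left)

text \<open>This produces the frontier point that violates the cone condition. Moving from
  \<open>s\<close> to an interior point \<open>s'\<close> provides a ball in \<open>S\<close>, hence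
  points diagonally below \<open>s'\<close> on both sides; these are also diagonally below any
  \<open>w\<close> vertically above \<open>s'\<close>.\<close>

lemma four_quadrants_meet:
  fixes S :: "(real^2) set"
  assumes "closed S" "S = closure (interior S)" "orthonormal u v"
    and pqr: "p \<in> S" "q \<in> S" "r \<notin> S" "p \<bullet> v = r \<bullet> v" "q \<bullet> v = r \<bullet> v"
      "p \<bullet> u < r \<bullet> u" "r \<bullet> u < q \<bullet> u"
    and s: "s \<in> S" "s \<bullet> u = r \<bullet> u" "s \<bullet> v < r \<bullet> v"
  obtains w where "w \<in> frontier S"
    "\<And>a b. a \<in> {u, -u} \<Longrightarrow> b \<in> {v, -v} \<Longrightarrow> quadrant a b w \<inter> S \<noteq> {}"
proof -
  have uv: "u \<bullet> u = 1" "v \<bullet> v = 1" "u \<bullet> v = 0" "v \<bullet> u = 0" "norm u = 1" "norm v = 1"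
    using assms(3) by (auto simp: orthonormal_def norm_eq_sqrt_inner)
  have "open (- S)"
    using \<open>closed S\<close> by (simp add: open_Compl)
  then obtain \<epsilon> where "\<epsilon> > 0" "ball r \<epsilon> \<subseteq> - S"
    using \<open>r \<notin> S\<close> by (metis ComplI openE)
  \<comment> \<open>The bound \<open>\<epsilon>\<close> keeps the shifted point \<open>r'\<close>
    outside \<open>S\<close>, the second entry keeps \<open>s'\<close> below the height of
    \<open>r\<close>, and the last two keep \<open>s'\<close> strictly between \<open>p\<close> and
    \<open>q\<close> horizontally.\<close>
  define \<eta> where "\<eta> = Min {\<epsilon>, r \<bullet> v - s \<bullet> v, r \<bullet> u - p \<bullet> u, q \<bullet> u - r \<bullet> u}"
  have "\<eta> > 0"
    using \<open>\<epsilon> > 0\<close> assms by (auto simp: \<eta>_def)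
  have \<eta>: "\<eta> \<le> \<epsilon>" "\<eta> \<le> r \<bullet> v - s \<bullet> v" "\<eta> \<le> r \<bullet> u - p \<bullet> u" "\<eta> \<le> q \<bullet> u - r \<bullet> u"
    by (simp_all add: \<eta>_def min_le_iff_disj)
  obtain s' where s': "s' \<in> interior S" "dist s' s < \<eta>"
    using s(1) assms(2) \<open>\<eta> > 0\<close> closure_approachable by metis
  have "\<bar>(s' - s) \<bullet> u\<bar> < \<eta>" "\<bar>(s' - s) \<bullet> v\<bar> < \<eta>"
    using s'(2) Cauchy_Schwarz_ineq2[of "s' - s" u] Cauchy_Schwarz_ineq2[of "s' - s" v] uv
    by (auto simp: dist_norm)
  then have near: "\<bar>s' \<bullet> u - r \<bullet> u\<bar> < \<eta>" "s' \<bullet> v < s \<bullet> v + \<eta>"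
    using s by (auto simp: inner_diff_left)
  define r' where "r' = r + (s' \<bullet> u - r \<bullet> u) *\<^sub>R u"
  have r': "r' \<bullet> u = s' \<bullet> u" "r' \<bullet> v = r \<bullet> v"
    using uv by (auto simp: r'_def inner_add_left)
  have "dist r r' < \<epsilon>"
    using near \<eta> uv by (simp add: r'_def dist_norm)
  then have "r' \<notin> S"
    using \<open>ball r \<epsilon> \<subseteq> - S\<close> by auto
  moreover have "s' \<in> S"
    using s'(1) interior_subset by blast
  ultimately have "closed_segment s' r' \<inter> frontier S \<noteq> {}"
    by (intro connected_Int_frontier) auto
  then obtain w where "w \<in> frontier S" "w \<in> closed_segment s' r'"
    by blast
  then obtain t where w: "w \<in> frontier S" "w = (1 - t) *\<^sub>R s' + t *\<^sub>R r'" "0 \<le> t" "t \<le> 1"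
    unfolding in_segment by blast
  have "w \<in> S"
    using w(1) \<open>closed S\<close> frontier_subset_closed by blast
  have wu: "w \<bullet> u = s' \<bullet> u"
    using r' by (simp add: w(2) inner_add_left algebra_simps)
  have wv: "w \<bullet> v = s' \<bullet> v + t * (r \<bullet> v - s' \<bullet> v)"
    using r' by (simp add: w(2) inner_add_left algebra_simps)
  have lt: "s' \<bullet> v < r \<bullet> v"
    using near \<eta> by simp
  \<comment> \<open>Hence \<open>w\<close> is strictly below the height of \<open>r\<close>, which
    puts \<open>p\<close> and \<open>q\<close> into the open upper quadrants at
    \<open>w\<close>.\<close>
  have "t \<noteq> 1"
    using w(2) \<open>w \<in> S\<close> \<open>r' \<notin> S\<close> by auto
  then have "t * (r \<bullet> v - s' \<bullet> v) < r \<bullet> v - s' \<bullet> v" "0 \<le> t * (r \<bullet> v - s' \<bullet> v)"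
    using w(3,4) lt by auto
  then have wv': "s' \<bullet> v \<le> w \<bullet> v" "w \<bullet> v < r \<bullet> v"
    unfolding wv by linarith+
  obtain d where "d > 0" "ball s' d \<subseteq> S"
    using s'(1) by (meson mem_interior)
  \<comment> \<open>With \<open>c\<close> equal to \<open>u\<close> or \<open>-u\<close> this is a
    diagonal step down. Its length is at most \<open>2 * d / 3\<close>, so it stays in the
    ball.\<close>
  have low: "s' + (d/3) *\<^sub>R (c - v) \<in> S" if "norm c = 1" for c
  proof -
    have "norm (c - v) \<le> 2"
      using norm_triangle_ineq4[of c v] that uv by simp
    then have "norm ((d/3) *\<^sub>R (c - v)) < d"
      using \<open>d > 0\<close> by simp
    then show ?thesis
      using \<open>ball s' d \<subseteq> S\<close> by (auto simp: dist_norm subset_iff)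
  qed
  have "s' + (d/3) *\<^sub>R (u - v) \<in> quadrant u (-v) w" "s' + (d/3) *\<^sub>R (- u - v) \<in> quadrant (-u) (-v) w"
    "q \<in> quadrant u v w" "p \<in> quadrant (-u) v w"
    using wu wv' near \<eta> pqr uv \<open>d > 0\<close>
    by (auto simp: quadrant_def inner_add_left inner_diff_left)
  then have "quadrant a b w \<inter> S \<noteq> {}" if "a \<in> {u, -u}" "b \<in> {v, -v}" for a b
    using that low[of u] low[of "-u"] uv pqr by auto
  with w(1) show ?thesis by (rule that)
qed

text \<open>The segments from \<open>p\<close> and \<open>q\<close> to a missing point
  \<open>r\<close> contain frontier points on either side of the vertical line through
  \<open>r\<close>. The connected frontier therefore crosses that line, at a point \<open>s\<close>
  other than \<open>r\<close>.\<close>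

lemma line_convex_if_free_quadrants:
  fixes S :: "(real^2) set"
  assumes "closed S" "S = closure (interior S)" "connected (frontier S)" "orthonormal u v"
    and free: "\<And>x. x \<in> frontier S \<Longrightarrow> \<exists>a\<in>{u, -u}. \<exists>b\<in>{v, -v}. quadrant a b x \<inter> S = {}"
  shows "line_convex v u S"
  unfolding line_convex_def
proof (intro ballI allI impI, rule ccontr, elim conjE)
  fix p q r
  assume pq: "p \<in> S" "q \<in> S" "r \<notin> S" "p \<bullet> v = r \<bullet> v" "q \<bullet> v = r \<bullet> v"
    and le: "p \<bullet> u \<le> r \<bullet> u" "r \<bullet> u \<le> q \<bullet> u"
  \<comment> \<open>Equality would give \<open>p\<close> or \<open>q\<close> the same coordinates as
    \<open>r\<close>, which is not in \<open>S\<close>.\<close>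
  have lt: "p \<bullet> u < r \<bullet> u" "r \<bullet> u < q \<bullet> u"
    using pq le orthonormal_plane_eqI[OF assms(4), of p r] orthonormal_plane_eqI[OF assms(4), of q r]
    by force+
  have seg: "\<exists>f\<in>frontier S. f \<in> closed_segment y r" if "y \<in> S" for y
    using connected_Int_frontier[of "closed_segment y r" S] that \<open>r \<notin> S\<close> by auto
  obtain f where f: "f \<in> frontier S" "f \<in> closed_segment p r"
    using seg[OF \<open>p \<in> S\<close>] by blast
  obtain g where g: "g \<in> frontier S" "g \<in> closed_segment q r"
    using seg[OF \<open>q \<in> S\<close>] by blast
  have "closed_segment p r \<subseteq> {z. u \<bullet> z \<le> r \<bullet> u}"
    using le by (intro closed_segment_subset convex_halfspace_le) (auto simp: inner_commute)
  moreover have "closed_segment q r \<subseteq> {z. u \<bullet> z \<ge> r \<bullet> u}"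
    using le by (intro closed_segment_subset convex_halfspace_ge) (auto simp: inner_commute)
  ultimately obtain s where s: "s \<in> frontier S" "u \<bullet> s = r \<bullet> u"
    using connected_ivt_hyperplane[OF assms(3) f(1) g(1), of u "r \<bullet> u"] f(2) g(2) by auto
  have "s \<in> S"
    using s(1) \<open>closed S\<close> frontier_subset_closed by blast
  have su: "s \<bullet> u = r \<bullet> u"
    using s(2) by (simp add: inner_commute)
  have "s \<bullet> v \<noteq> r \<bullet> v"
    using orthonormal_plane_eqI[OF assms(4) su] \<open>s \<in> S\<close> \<open>r \<notin> S\<close> by auto
  \<comment> \<open>If \<open>s\<close> lies above \<open>r\<close>, reflecting \<open>v\<close> to
    \<open>-v\<close> puts it below; the set of four quadrants is unchanged.\<close>
  then consider "s \<bullet> v < r \<bullet> v" | "s \<bullet> (-v) < r \<bullet> (-v)"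
    by (auto simp: linorder_neq_iff)
  then show False
  proof cases
    case 1
    show ?thesis
      by (rule four_quadrants_meet[OF assms(1,2,4) pq lt \<open>s \<in> S\<close> su 1]) (use free in blast)
  next
    case 2
    have "orthonormal u (-v)" "p \<bullet> (-v) = r \<bullet> (-v)" "q \<bullet> (-v) = r \<bullet> (-v)"
      using pq assms(4) by auto
    show ?thesis
    proof (rule four_quadrants_meet[OF assms(1,2) \<open>orthonormal u (-v)\<close> pq(1-3)
          \<open>p \<bullet> (-v) = r \<bullet> (-v)\<close> \<open>q \<bullet> (-v) = r \<bullet> (-v)\<close> lt \<open>s \<in> S\<close> su 2])
      fix w assume "w \<in> frontier S"
        "\<And>a b. a \<in> {u, -u} \<Longrightarrow> b \<in> {-v, - (-v)} \<Longrightarrow> quadrant a b w \<inter> S \<noteq> {}"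
      then show False
        using free[of w] by auto
    qed
  qed
qed

section \<open>Translation from lines, cones and rotations to coordinates\<close>

lemma convex_line_iff_line_convex:
  fixes u v :: "real^2"
  assumes "orthonormal u v"
  shows "(\<forall>\<alpha>. convex ({\<alpha> *\<^sub>R u + t *\<^sub>R v | t. t \<in> UNIV} \<inter> S)) \<longleftrightarrow> line_convex u v S"
proof -
  have line: "{\<alpha> *\<^sub>R u + t *\<^sub>R v | t. t \<in> UNIV} = {z. z \<bullet> u = \<alpha>}" for \<alpha>
  proof (intro set_eqI iffI)
    fix z assume "z \<in> {z. z \<bullet> u = \<alpha>}"
    then show "z \<in> {\<alpha> *\<^sub>R u + t *\<^sub>R v | t. t \<in> UNIV}"
      using orthonormal_plane_expand[OF assms, of z] by auto
  qed (use assms in \<open>auto simp: orthonormal_def inner_add_left\<close>)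
  show ?thesis
    unfolding line
  proof
    assume conv: "\<forall>\<alpha>. convex ({z. z \<bullet> u = \<alpha>} \<inter> S)"
    show "line_convex u v S"
      unfolding line_convex_def
    proof (intro ballI allI impI, elim conjE)
      fix p q z
      assume *: "p \<in> S" "q \<in> S" "p \<bullet> u = z \<bullet> u" "q \<bullet> u = z \<bullet> u" "p \<bullet> v \<le> z \<bullet> v" "z \<bullet> v \<le> q \<bullet> v"
      then have "z \<bullet> v \<in> closed_segment (p \<bullet> v) (q \<bullet> v)"
        by (auto simp: closed_segment_eq_real_ivl)
      then obtain t where t: "0 \<le> t" "t \<le> 1" "z \<bullet> v = (1 - t) * (p \<bullet> v) + t * (q \<bullet> v)"
        by (auto simp: in_segment)
      \<comment> \<open>The weight \<open>t\<close> was found from the \<open>v\<close>-coordinates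
        alone; it also fits the \<open>u\<close>-coordinates, which all agree.\<close>
      have "z = (1 - t) *\<^sub>R p + t *\<^sub>R q"
        using * t by (intro orthonormal_plane_eqI[OF assms]) (auto simp: inner_add_left algebra_simps)
      then have "z \<in> closed_segment p q"
        using t by (auto simp: in_segment)
      moreover have "closed_segment p q \<subseteq> {y. y \<bullet> u = z \<bullet> u} \<inter> S"
        using * conv by (intro closed_segment_subset) auto
      ultimately show "z \<in> S" by blast
    qed
  next
    assume lc: "line_convex u v S"
    have "z \<in> S" if "p \<in> S" "q \<in> S" "p \<bullet> u = q \<bullet> u" and z: "z \<in> closed_segment p q" for p q z
    proof -
      obtain t where t: "0 \<le> t" "t \<le> 1" "z = (1 - t) *\<^sub>R p + t *\<^sub>R q"
        using z by (auto simp: in_segment)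
      have zu: "z \<bullet> u = q \<bullet> u"
        using that by (simp add: t inner_add_left algebra_simps)
      have "z \<bullet> v \<in> closed_segment (p \<bullet> v) (q \<bullet> v)"
        using t by (auto simp: in_segment inner_add_left intro!: exI[of _ t])
      then consider "p \<bullet> v \<le> z \<bullet> v" "z \<bullet> v \<le> q \<bullet> v" | "q \<bullet> v \<le> z \<bullet> v" "z \<bullet> v \<le> p \<bullet> v"
        by (auto simp: closed_segment_eq_real_ivl split: if_splits)
      then show ?thesis
        using line_convexD[OF lc that(1,2)] line_convexD[OF lc that(2,1)] zu that(3)
        by cases simp_all
    qed
    moreover have "convex {z. z \<bullet> u = \<alpha>}" for \<alpha>
      using convex_hyperplane[of u \<alpha>] by (simp add: inner_commute)
    ultimately show "\<forall>\<alpha>. convex ({z. z \<bullet> u = \<alpha>} \<inter> S)"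
      unfolding convex_contains_segment by blast
  qed
qed

lemma biconvex_iff_line_convex:
  assumes "orthonormal u v"
  shows "biconvex u v S \<longleftrightarrow> line_convex u v S \<and> line_convex v u S"
  unfolding biconvex_def convex_line_iff_line_convex[OF assms, symmetric]
    convex_line_iff_line_convex[OF orthonormal_sym[OF assms], symmetric]
  by (simp add: add.commute)

text \<open>If \<open>a\<close> and \<open>b\<close> are the coordinates of \<open>z - x\<close>,
  the cone condition says that \<open>a + b\<close> exceeds the norm of \<open>z - x\<close>.
  Squaring turns this into \<open>a * b > 0\<close> together with \<open>a + b > 0\<close>, that is,
  both coordinates are positive.\<close>

lemma open_cone_eq_quadrant:
  assumes "orthonormal u v"
  shows "open_cone ((u + v) /\<^sub>R sqrt 2) x = quadrant u v x"
proof -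
  have "z \<noteq> x \<and> ((u + v) /\<^sub>R sqrt 2) \<bullet> ((z - x) /\<^sub>R norm (z - x)) > cos (pi / 4) \<longleftrightarrow>
      z \<bullet> u > x \<bullet> u \<and> z \<bullet> v > x \<bullet> v" for z
  proof (cases "z = x")
    case False
    define a b where "a = (z - x) \<bullet> u" and "b = (z - x) \<bullet> v"
    have zx: "z - x = a *\<^sub>R u + b *\<^sub>R v"
      unfolding a_def b_def by (rule orthonormal_plane_expand[OF assms])
    have "norm (z - x) ^ 2 = a\<^sup>2 + b\<^sup>2"
      using assms unfolding zx power2_norm_eq_inner
      by (simp add: orthonormal_def inner_add_left inner_add_right power2_eq_square)
    then have norm: "norm (z - x) = sqrt (a\<^sup>2 + b\<^sup>2)"
      by (metis norm_ge_zero real_sqrt_unique)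
    have pos: "norm (z - x) > 0"
      using False by simp
    have "(u + v) \<bullet> (z - x) = a + b"
      unfolding a_def b_def inner_add_left by (simp only: inner_commute)
    then have "((u + v) /\<^sub>R sqrt 2) \<bullet> ((z - x) /\<^sub>R norm (z - x)) = (a + b) / (sqrt 2 * norm (z - x))"
      by (simp add: divide_simps)
    moreover have "cos (pi / 4) = 1 / sqrt 2"
      by (simp add: cos_45 field_simps)
    ultimately have "((u + v) /\<^sub>R sqrt 2) \<bullet> ((z - x) /\<^sub>R norm (z - x)) > cos (pi / 4) \<longleftrightarrow>
        (a + b) / (sqrt 2 * norm (z - x)) > 1 / sqrt 2"
      by (simp only:)
    also have "\<dots> \<longleftrightarrow> a + b > norm (z - x)"
      using pos by (simp add: divide_simps)
    also have "\<dots> \<longleftrightarrow> a > 0 \<and> b > 0"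
    proof
      assume "a + b > norm (z - x)"
      then have "a + b > 0" "(a + b)\<^sup>2 > (norm (z - x))\<^sup>2"
        using pos by (linarith, simp add: power_strict_mono)
      then have "a * b > 0" "a + b > 0"
        by (auto simp: \<open>norm (z - x) ^ 2 = a\<^sup>2 + b\<^sup>2\<close> power2_sum)
      then show "a > 0 \<and> b > 0"
        by (auto simp: zero_less_mult_iff)
    next
      assume ab: "a > 0 \<and> b > 0"
      then have "a\<^sup>2 + b\<^sup>2 < (a + b)\<^sup>2"
        by (simp add: power2_sum)
      then show "a + b > norm (z - x)"
        unfolding norm using ab by (intro real_less_lsqrt) auto
    qed
    finally show ?thesis
      using False by (simp add: a_def b_def inner_diff_left)
  qed simp
  then show ?thesis
    by (auto simp: open_cone_def quadrant_def)
qed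

text \<open>The two cases are the two orientations of the basis. Since
  \<open>rot90 a \<bullet> b\<close> is the determinant of \<open>a\<close> and \<open>b\<close>,
  the coordinates of \<open>rot90 u\<close> and \<open>rot90 v\<close> are zero or plus or minus the
  determinant \<open>d\<close>; and \<open>d * d = 1\<close> because the rotation preserves
  length.\<close>

lemma rot90_orthonormal:
  assumes "orthonormal u v"
  obtains "rot90 u = v" "rot90 v = -u" | "rot90 u = -v" "rot90 v = u"
proof -
  have rot: "rot90 a \<bullet> b = a $ 1 * b $ 2 - a $ 2 * b $ 1" for a b
    by (simp add: rot90_def inner_vec_def sum_2)
  define d where "d = u $ 1 * v $ 2 - u $ 2 * v $ 1"
  have "rot90 u = d *\<^sub>R v" "rot90 v = - d *\<^sub>R u"
    using assms by (auto intro!: orthonormal_plane_eqI[OF assms] simp: rot d_def orthonormal_def algebra_simps)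
  moreover have "rot90 u \<bullet> rot90 u = u \<bullet> u"
    by (simp add: rot90_def inner_vec_def sum_2)
  ultimately have "d * d = 1"
    using assms by (simp add: orthonormal_def)
  then have "d = 1 \<or> d = -1"
    by (simp add: square_eq_1_iff)
  then show ?thesis
    using that \<open>rot90 u = d *\<^sub>R v\<close> \<open>rot90 v = - d *\<^sub>R u\<close> by auto
qed

lemma rot90_linear: "rot90 (a + b) = rot90 a + rot90 b" "rot90 (c *\<^sub>R a) = c *\<^sub>R rot90 a"
  "rot90 (- a) = - rot90 a"
  by (simp_all add: rot90_def vec_eq_iff forall_2)

text \<open>The four rotations of the diagonal direction are exactly the four sign choices. The
  orientation of the basis only decides in which order they are visited.\<close>

lemma ex_free_cone_iff_ex_free_quadrant:
  assumes "orthonormal u v"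
  shows "(\<exists>i\<in>{0,1,2,3::nat}. open_cone ((rot90 ^^ i) ((u + v) /\<^sub>R sqrt 2)) x \<inter> S = {}) \<longleftrightarrow>
    (\<exists>a\<in>{u, -u}. \<exists>b\<in>{v, -v}. quadrant a b x \<inter> S = {})"
proof -
  have cone: "open_cone ((u + v) /\<^sub>R sqrt 2) x = quadrant u v x"
    "open_cone ((u + -v) /\<^sub>R sqrt 2) x = quadrant u (-v) x"
    "open_cone ((-u + v) /\<^sub>R sqrt 2) x = quadrant (-u) v x"
    "open_cone ((-u + -v) /\<^sub>R sqrt 2) x = quadrant (-u) (-v) x"
    by (rule open_cone_eq_quadrant, simp add: assms)+
  let ?\<xi> = "(u + v) /\<^sub>R sqrt 2"
  have i: "(rot90 ^^ 0) ?\<xi> = ?\<xi>" "(rot90 ^^ 1) ?\<xi> = rot90 ?\<xi>"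
    "(rot90 ^^ 2) ?\<xi> = rot90 (rot90 ?\<xi>)" "(rot90 ^^ 3) ?\<xi> = rot90 (rot90 (rot90 ?\<xi>))"
    by (simp_all add: numeral_2_eq_2 numeral_3_eq_3)
  from assms have "(\<lambda>i. (rot90 ^^ i) ?\<xi>) ` {0,1,2,3::nat} =
    {(u + v) /\<^sub>R sqrt 2, (u + -v) /\<^sub>R sqrt 2, (-u + v) /\<^sub>R sqrt 2, (-u + -v) /\<^sub>R sqrt 2}"
  proof (cases rule: rot90_orthonormal)
    case 1
    then have "rot90 ?\<xi> = (-u + v) /\<^sub>R sqrt 2" "rot90 ((-u + v) /\<^sub>R sqrt 2) = (-u + -v) /\<^sub>R sqrt 2"
      "rot90 ((-u + -v) /\<^sub>R sqrt 2) = (u + -v) /\<^sub>R sqrt 2"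
      by (simp_all only: rot90_linear minus_minus add.commute)
    then show ?thesis
      unfolding image_insert image_empty i by (simp only:) blast
  next
    case 2
    then have "rot90 ?\<xi> = (u + -v) /\<^sub>R sqrt 2" "rot90 ((u + -v) /\<^sub>R sqrt 2) = (-u + -v) /\<^sub>R sqrt 2"
      "rot90 ((-u + -v) /\<^sub>R sqrt 2) = (-u + v) /\<^sub>R sqrt 2"
      by (simp_all only: rot90_linear minus_minus add.commute)
    then show ?thesis
      unfolding image_insert image_empty i by (simp only:) blast
  qed
  moreover have "(\<exists>i\<in>{0,1,2,3::nat}. open_cone ((rot90 ^^ i) ?\<xi>) x \<inter> S = {}) \<longleftrightarrow>
    (\<exists>w\<in>(\<lambda>i. (rot90 ^^ i) ?\<xi>) ` {0,1,2,3::nat}. open_cone w x \<inter> S = {})"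
    by blast
  ultimately show ?thesis
    by (simp only: cone bex_simps simp_thms) blast
qed

section \<open>Equivalence of biconvexity and the free cone condition\<close>

theorem theorem1:
  fixes S :: "(real^2) set" and b1 b2 \<xi> :: "real^2"
  assumes "closed S"
    and "path_connected (frontier S)"
    and "S = closure (interior S)"
    and "norm b1 = 1" and "norm b2 = 1" and "b1 \<bullet> b2 = 0"
    and "\<xi> = (b1 + b2) /\<^sub>R norm (b1 + b2)"
  shows "biconvex b1 b2 S \<longleftrightarrow>
    (\<forall>x\<in>frontier S. \<exists>i\<in>{0,1,2,3::nat}. open_cone ((rot90 ^^ i) \<xi>) x \<inter> S = {})"
proof -
  have on: "orthonormal b1 b2"
    using assms(4-6) by (simp add: orthonormal_def norm_eq_1 inner_commute)
  have "norm (b1 + b2) = sqrt 2"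
    using on by (simp add: norm_eq_sqrt_inner orthonormal_def inner_add_left inner_add_right)
  then have cone: "(\<exists>i\<in>{0,1,2,3::nat}. open_cone ((rot90 ^^ i) \<xi>) x \<inter> S = {}) \<longleftrightarrow>
      (\<exists>a\<in>{b1, -b1}. \<exists>b\<in>{b2, -b2}. quadrant a b x \<inter> S = {})" for x
    using ex_free_cone_iff_ex_free_quadrant[OF on] assms(7) by simp
  have conF: "connected (frontier S)"
    using assms(2) by (rule path_connected_imp_connected)
  show ?thesis
    unfolding cone biconvex_iff_line_convex[OF on]
  proof (intro iffI ballI conjI)
    fix x assume lc: "line_convex b1 b2 S \<and> line_convex b2 b1 S" and x: "x \<in> frontier S"
    have "x \<in> S" "x \<notin> interior S"
      using x \<open>closed S\<close> by (auto simp: frontier_def)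
    moreover have "connected S"
      using \<open>closed S\<close> conF by (rule connected_of_connected_frontier)
    ultimately show "\<exists>a\<in>{b1, -b1}. \<exists>b\<in>{b2, -b2}. quadrant a b x \<inter> S = {}"
      using interior_if_quadrants_meet[OF _ on, of S x] lc by metis
  next
    assume free: "\<forall>x\<in>frontier S. \<exists>a\<in>{b1, -b1}. \<exists>b\<in>{b2, -b2}. quadrant a b x \<inter> S = {}"
    then show "line_convex b2 b1 S"
      using line_convex_if_free_quadrants[OF assms(1,3) conF on] by blast
    \<comment> \<open>The free quadrant condition is symmetric in the two vectors, so exchanging
      them gives convexity along the other family of lines.\<close>
    have "\<exists>a\<in>{b2, -b2}. \<exists>b\<in>{b1, -b1}. quadrant a b x \<inter> S = {}" if "x \<in> frontier S" for x
      using free that by (auto simp: quadrant_def conj_commute)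
    then show "line_convex b1 b2 S"
      by (rule line_convex_if_free_quadrants[OF assms(1,3) conF orthonormal_sym[OF on]])
  qed
qed

end
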